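(* Let $X$ and $Y$ be independent identically distributed log-concave random variables on $\mathbb{Z}$, and let $\alpha\in(0,\infty]$. Then $$H_\alpha(X-Y)-H_\alpha(X)<\log c(\alpha),$$ where $$c(\alpha)=\begin{cases}2\,\alpha^{\frac{1}{\alpha-1}}, & \alpha\in(2,\infty],\\ \alpha^{\frac{1}{\alpha-1}}, & \alpha\in(0,2].\end{cases}$$
   Context: A $\mathbb{Z}$-valued random variable $X$ is log-concave if the sequence $p_n=\mathbb{P}(X=n)$, $n\in\mathbb{Z}$, satisfies $p_n^2\ge p_{n-1}p_{n+1}$ for all $n\in\mathbb{Z}$ and its support $\{n:p_n>0\}$ is a contiguous interval of integers (whenever $a\le b$ are in the support, so is every integer between $a$ and $b$). Rényi entropy: for a $\mathbb{Z}$-valued random variable $X$ with $p_n=\mathbb{P}(X=n)$ and $\alpha\in(0,1)\cup(1,\infty)$, $H_\alpha(X)=\frac{1}{1-\alpha}\log\sum_{n:p_n>0}p_n^\alpha$; $H_1(X)=-\sum_{n:p_n>0}p_n\log p_n$ (Shannon entropy); $H_\infty(X)=-\log\sup_n p_n$. Conventions: $\alpha^{\frac{1}{\alpha-1}}$ is interpreted as $e$ for $\alpha=1$ and as $1$ for $\alpha=\infty$. Here $\log$ is the logarithm to any fixed base greater than $1$ (e.g. natural). *)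

theory Defs
  imports "HOL-Probability.Probability"
begin

definition mass :: "'a measure \<Rightarrow> ('a \<Rightarrow> int) \<Rightarrow> int \<Rightarrow> real" where
  "mass M X n = \<P>(\<omega> in M. X \<omega> = n)"

definition log_concave_rv :: "'a measure \<Rightarrow> ('a \<Rightarrow> int) \<Rightarrow> bool" where
  "log_concave_rv M X \<longleftrightarrow>
     (\<forall>n. (mass M X n)\<^sup>2 \<ge> mass M X (n - 1) * mass M X (n + 1)) \<and>
     (\<forall>i j k. mass M X i > 0 \<longrightarrow> mass M X k > 0 \<longrightarrow> i \<le> j \<longrightarrow> j \<le> k \<longrightarrow> mass M X j > 0)"

text \<open>
  The entropy is extended-real valued. Both series have nonnegative terms (up to a global sign
  for order 1), so a series that is not summable has the sum \<open>\<infinity>\<close>; for order greater than 1 this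
  cannot happen, and for orders in \<open>(0,1]\<close> it makes the entropy \<open>\<infinity>\<close>. Only orders
  \<open>\<alpha> > 0\<close> are meaningful. The parameter \<open>b\<close> is the base of the logarithm.
\<close>

definition renyi_entropy :: "real \<Rightarrow> ereal \<Rightarrow> 'a measure \<Rightarrow> ('a \<Rightarrow> int) \<Rightarrow> ereal" where
  "renyi_entropy b \<alpha> M X =
     (let p = mass M X; S = {n. p n > 0}; a = real_of_ereal \<alpha> in
      if \<alpha> = \<infinity> then ereal (- log b (SUP n. p n))
      else if \<alpha> = 1 then
        (if (\<lambda>n. p n * log b (p n)) summable_on S
         then ereal (- (\<Sum>\<^sub>\<infinity>n\<in>S. p n * log b (p n))) else \<infinity>)
      else
        (if (\<lambda>n. p n powr a) summable_on S
         then ereal (1 / (1 - a) * log b (\<Sum>\<^sub>\<infinity>n\<in>S. p n powr a)) else \<infinity>))"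

text \<open>\<open>\<alpha>\<close> to the power \<open>1 / (\<alpha> - 1)\<close>, with its limiting values at 1 and \<open>\<infinity>\<close>.\<close>

definition alpha_pow :: "ereal \<Rightarrow> real" where
  "alpha_pow \<alpha> =
     (if \<alpha> = 1 then exp 1
      else if \<alpha> = \<infinity> then 1
      else real_of_ereal \<alpha> powr (1 / (real_of_ereal \<alpha> - 1)))"

definition c_const :: "ereal \<Rightarrow> real" where
  "c_const \<alpha> = (if \<alpha> > 2 then 2 * alpha_pow \<alpha> else alpha_pow \<alpha>)"

end

theory Submission
  imports Defs
begin

text \<open>
  Write \<open>Z = X - Y\<close>, and let \<open>p\<close> and \<open>r\<close> be the mass functions of \<open>X\<close> and \<open>Z\<close>. Two observations
  reduce the theorem to a comparison of entropies of different orders of one variable. First, \<open>Z\<close>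
  is again log-concave (\<open>difference_log_concave\<close>, by the Cauchy-Binet formula). Second, \<open>Z\<close> is
  symmetric, so its most probable value is 0, and \<open>r 0 = (\<Sum>n. (p n)\<^sup>2)\<close>; that is, the entropy of
  order \<open>\<infinity>\<close> of \<open>Z\<close> is the entropy of order 2 of \<open>X\<close>.

  The main inequality (\<open>qlog_sum_bound\<close>) says that for a log-concave variable and finite \<open>\<alpha>\<close>
  \[ H_\alpha < H_\infty + \log \alpha^{1/(\alpha-1)} . \]
  Applied to \<open>Z\<close>, it gives $H_\alpha(Z) < H_2(X) + \log \alpha^{1/(\alpha-1)}$. If $\alpha \le 2$,
  then $H_2(X) \le H_\alpha(X)$ and the proof is complete. If $\alpha > 2$, the main inequality of
  order 2, applied to \<open>X\<close>, gives $H_2(X) < H_\infty(X) + \log 2 \le H_\alpha(X) + \log 2$, which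
  accounts for the additional factor 2. For $\alpha = \infty$ the last step is already the
  claim.

  The main inequality holds because, for a given maximum, two-sided geometric sequences are extremal.
  Scale the maximum to 1 and cut the sequence there into two halves. Each half is a log-concave
  sequence that starts at 1; it crosses the geometric sequence with the same sum exactly once, unless
  the two are equal
  (\<open>log_concave_crosses_geometric_once\<close>), and a convex function compares the two sums in the required
  direction (\<open>one_sided_qlog_sum_bound\<close>). For geometric sequences the inequality says that \<open>u * coth u\<close>
  is strictly increasing (\<open>geometric_qlog_sum_bound\<close>).

  All finite orders, including 1, are treated at once with the deformed logarithm
  \<open>qlog a x = (x powr (a - 1) - 1) / (a - 1)\<close>: the entropy of order \<open>a\<close> is \<open>- log b v\<close> for the number
  \<open>v\<close> with \<open>qlog a v = (\<Sum>n. p n * qlog a (p n))\<close> (\<open>renyi_entropy_eq_log\<close>).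
\<close>

section \<open>The deformed logarithm\<close>

text \<open>
  The logarithm that makes the orders 1 and \<open>a \<noteq> 1\<close> uniform: its derivative is \<open>x powr (a - 2)\<close> in
  both cases, and \<open>\<Sum>n. p n * qlog a (p n)\<close> is the negative of the Tsallis entropy of order \<open>a\<close>.
\<close>

definition qlog :: "real \<Rightarrow> real \<Rightarrow> real" where
  "qlog a x = (if a = 1 then ln x else (x powr (a - 1) - 1) / (a - 1))"

lemma qlog_1 [simp]: "qlog a 1 = 0"
  by (simp add: qlog_def)

lemma has_real_derivative_qlog:
  assumes "x > 0"
  shows "(qlog a has_real_derivative x powr (a - 2)) (at x)"
proof (cases "a = 1")
  case True
  have "(ln has_real_derivative x powr (a - 2)) (at x)"
    using DERIV_ln_divide[OF assms] assms True by (simp add: powr_minus_divide)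
  then show ?thesis by (simp add: qlog_def[abs_def] True)
next
  case False
  have "((\<lambda>x. (x powr (a - 1) - 1) / (a - 1)) has_real_derivative
      ((a - 1) * x powr (a - 1 - 1)) / (a - 1)) (at x)"
    using assms by (auto intro!: derivative_eq_intros)
  then show ?thesis using False by (simp add: qlog_def[abs_def])
qed

lemma qlog_less:
  assumes "0 < x" "x < y"
  shows "qlog a x < qlog a y"
proof (rule DERIV_pos_imp_increasing[OF assms(2)])
  fix z assume "x \<le> z" "z \<le> y"
  then show "\<exists>D. (qlog a has_real_derivative D) (at z) \<and> 0 < D"
    using assms has_real_derivative_qlog[of z a] by (intro exI[of _ "z powr (a - 2)"]) simp
qed

lemma qlog_mono: "0 < x \<Longrightarrow> x \<le> y \<Longrightarrow> qlog a x \<le> qlog a y"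
  using qlog_less[of x y a] by (cases "x = y") auto

lemma qlog_less_iff: "0 < x \<Longrightarrow> 0 < y \<Longrightarrow> qlog a x < qlog a y \<longleftrightarrow> x < y"
  using qlog_less[of x y a] qlog_mono[of y x a] by linarith

lemma qlog_mult:
  assumes "x > 0" "y > 0"
  shows "qlog a (x * y) = qlog a x + x powr (a - 1) * qlog a y"
proof (cases "a = 1")
  case False
  have split: "(z * w - 1) / (a - 1) = (z - 1) / (a - 1) + z * ((w - 1) / (a - 1))" for z w
    unfolding times_divide_eq_right add_divide_distrib[symmetric] by (simp add: algebra_simps)
  show ?thesis using assms False by (simp only: qlog_def powr_mult if_False split)
qed (use assms in \<open>simp add: qlog_def ln_mult\<close>)

lemma qlog_le_minus_one:
  assumes "a \<le> 2" "x > 0"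
  shows "qlog a x \<le> x - 1"
proof -
  let ?g = "\<lambda>x. x - 1 - qlog a x"
  have d: "(?g has_real_derivative 1 - z powr (a - 2)) (at z)" if "z > 0" for z
    using has_real_derivative_qlog[OF that, of a] by (auto intro!: derivative_eq_intros)
  have "?g 1 \<le> ?g x"
  proof (cases "x \<ge> 1")
    case True
    show ?thesis
    proof (rule DERIV_nonneg_imp_nondecreasing[OF True])
      fix z :: real assume "1 \<le> z" "z \<le> x"
      then have "z powr (a - 2) \<le> z powr 0" using assms by (intro powr_mono) auto
      then show "\<exists>y. (?g has_real_derivative y) (at z) \<and> 0 \<le> y"
        using d[of z] \<open>1 \<le> z\<close> by (intro exI[of _ "1 - z powr (a - 2)"]) simp
    qed
  next
    case False
    then have "x \<le> 1" by simp
    then show ?thesis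
    proof (rule DERIV_nonpos_imp_nonincreasing)
      fix z :: real assume z: "x \<le> z" "z \<le> 1"
      then have "z powr 0 \<le> z powr (a - 2)" using assms by (intro powr_mono') auto
      then show "\<exists>y. (?g has_real_derivative y) (at z) \<and> y \<le> 0"
        using d[of z] z assms by (intro exI[of _ "1 - z powr (a - 2)"]) simp
    qed
  qed
  then show ?thesis by simp
qed

text \<open>
  Inversion exchanges the orders \<open>a\<close> and \<open>2 - a\<close>; this turns the upper bound for \<open>a \<le> 2\<close> into a
  lower bound for \<open>a \<ge> 0\<close>.
\<close>

lemma qlog_inverse:
  assumes "x > 0"
  shows "qlog a (1 / x) = - qlog (2 - a) x"
proof (cases "a = 1")
  case False
  have "(1 / x) powr (a - 1) = x powr (1 - a)"
    using assms powr_minus[of x "a - 1"] by (simp add: powr_divide inverse_eq_divide)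
  moreover have "(z - 1) / (a - 1) = - ((z - 1) / (1 - a))" for z
    using False by (simp add: field_simps)
  ultimately show ?thesis using False by (simp add: qlog_def)
qed (use assms in \<open>simp add: qlog_def ln_div\<close>)

lemma qlog_ge_one_minus_inverse:
  assumes "a \<ge> 0" "x > 0"
  shows "1 - 1 / x \<le> qlog a x"
  using qlog_le_minus_one[of "2 - a" "1 / x"] qlog_inverse[of x "2 - (2 - a)"]
    qlog_inverse[of "1 / x" a] assms by simp

lemma mult_div_pred:
  fixes a w :: real
  assumes "a \<noteq> 1"
  shows "a * (w / (a - 1)) = w / (a - 1) + w"
proof -
  have "a * z = (a - 1) * z + z" for z by (simp add: algebra_simps)
  from this[of "w / (a - 1)"] show ?thesis using assms by simp
qed

text \<open>
  Convexity of \<open>x * qlog a x\<close> on \<open>x \<ge> 0\<close>, whose derivative is \<open>a * qlog a x + 1\<close>. By the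
  multiplication law for \<^const>\<open>qlog\<close> the tangent at \<open>y\<close> reduces to the tangent at 1,
  which is the lower bound \<open>1 - 1 / x\<close> for \<open>qlog a x\<close>. The value at \<open>x = 0\<close> is 0 because of the
  factor \<open>x\<close>.
\<close>

lemma mult_qlog_above_tangent:
  assumes "a > 0" "x \<ge> 0" "y > 0"
  shows "y * qlog a y + (a * qlog a y + 1) * (x - y) \<le> x * qlog a x"
proof -
  have slope: "a * qlog a y + 1 = qlog a y + y powr (a - 1)"
  proof (cases "a = 1")
    case False
    show ?thesis unfolding qlog_def if_not_P[OF False] mult_div_pred[OF False] by simp
  qed (use assms in \<open>simp add: qlog_def\<close>)
  show ?thesis
  proof (cases "x = 0")
    case True
    have "y * qlog a y + (a * qlog a y + 1) * (x - y) = - (y * y powr (a - 1))"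
      unfolding slope using True by (simp add: algebra_simps)
    then show ?thesis using True assms by simp
  next
    case False
    define z where "z = x / y"
    have z: "z > 0" "x = y * z" using False assms by (auto simp: z_def)
    have "z * (1 - 1 / z) \<le> z * qlog a z"
      using qlog_ge_one_minus_inverse[of a z] z assms by (intro mult_left_mono) auto
    then have *: "z - 1 \<le> z * qlog a z" using z by (simp add: algebra_simps)
    have "y * y powr (a - 1) * (z - 1) \<le> y * y powr (a - 1) * (z * qlog a z)"
      using * assms by (intro mult_left_mono) auto
    then show ?thesis unfolding slope z(2) qlog_mult[OF assms(3) z(1)]
      by (simp add: algebra_simps)
  qed
qed

section \<open>Geometric sequences\<close>

text \<open>
  This is \<open>u < sinh u\<close>, multiplied by \<open>2 * exp (-u)\<close>.
\<close>

lemma exp_minus_sq_less: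
  fixes u :: real
  assumes "u > 0"
  shows "0 < 1 - exp (-u) ^ 2 - 2 * u * exp (-u)"
proof -
  let ?h = "\<lambda>u::real. 1 - exp (-u) ^ 2 - 2 * u * exp (-u)"
  have "?h 0 < ?h u"
  proof (rule DERIV_pos_imp_increasing_open[OF assms])
    fix z :: real assume z: "0 < z" "z < u"
    have "(?h has_real_derivative 2 * exp (-z) * (exp (-z) - (1 - z))) (at z)"
      by (auto intro!: derivative_eq_intros simp: algebra_simps power2_eq_square)
    moreover have "1 - z < exp (-z)"
      using exp_minus_greater[of z] z by simp
    ultimately show "\<exists>y. (?h has_real_derivative y) (at z) \<and> 0 < y"
      by (intro exI[of _ "2 * exp (-z) * (exp (-z) - (1 - z))"]) simp
  qed (auto intro!: continuous_intros)
  then show ?thesis by simp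
qed

text \<open>
  The function is \<open>u * coth (u / 2)\<close>; the sign of its derivative is that of \<open>sinh u - u\<close>.
\<close>

lemma coth_mult_strict_mono:
  fixes u v :: real
  assumes "0 < u" "u < v"
  shows "u * (1 + exp (-u)) / (1 - exp (-u)) < v * (1 + exp (-v)) / (1 - exp (-v))"
proof (rule DERIV_pos_imp_increasing[OF assms(2)])
  fix z assume "u \<le> z" "z \<le> v"
  then have z: "z > 0" using assms by simp
  let ?D = "(1 - exp (-z) ^ 2 - 2 * z * exp (-z)) / (1 - exp (-z)) ^ 2"
  have "1 - exp (-z) > 0" using z by simp
  then have "((\<lambda>u. u * (1 + exp (-u)) / (1 - exp (-u))) has_real_derivative ?D) (at z)"
    by (auto intro!: derivative_eq_intros simp: algebra_simps power2_eq_square)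
  moreover have "?D > 0" using exp_minus_sq_less[OF z] z by simp
  ultimately show "\<exists>y. ((\<lambda>u. u * (1 + exp (-u)) / (1 - exp (-u))) has_real_derivative y) (at z)
      \<and> 0 < y" by blast
qed

lemma geometric_sums_Suc:
  fixes w :: real
  assumes "0 \<le> w" "w < 1"
  shows "(\<lambda>n. w ^ Suc n) sums (w / (1 - w))"
  using sums_mult[OF geometric_sums[of w], of w] assms by simp

text \<open>
  Let \<open>t = exp (-s)\<close>. For \<open>a \<noteq> 1\<close> both series are geometric, with ratios \<open>t\<close> and \<open>t powr a\<close>, and
  half-weighting the term of index 0 turns them into hyperbolic cotangents: the quantity is
  \<open>(a * coth (a * s / 2) - coth (s / 2)) / (2 * (a - 1))\<close>, which is positive since \<open>u * coth (u / 2)\<close>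
  increases. For \<open>a = 1\<close> the claim is \<open>s < sinh s\<close>. The summand \<open>1 / 2\<close> is the share of the term of
  index 0 that each half of a two-sided sequence receives.
\<close>

lemma geometric_qlog_sum_bound:
  assumes "a > 0" "0 < t" "t < 1"
  obtains L where "(\<lambda>n. t ^ Suc n * qlog a (t ^ Suc n)) sums L"
    "0 < a * L + t / (1 - t) + 1 / 2"
proof -
  define s where "s = - ln t"
  have s: "s > 0" "exp (-s) = t" using assms by (auto simp: s_def)
  show ?thesis
  proof (cases "a = 1")
    case True
    have "(\<lambda>n. ln t * t * (of_nat (Suc n) * t ^ n)) sums (ln t * t * (1 / (1 - t)^2))"
      using assms by (intro sums_mult geometric_deriv_sums) simp
    moreover have "ln t * t * (of_nat (Suc n) * t ^ n) = t ^ Suc n * qlog a (t ^ Suc n)" for n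
      using assms by (simp only: qlog_def True ln_realpow if_True) simp
    ultimately have sm: "(\<lambda>n. t ^ Suc n * qlog a (t ^ Suc n)) sums (ln t * t * (1 / (1 - t)^2))"
      by (simp only:)
    have "0 < (1 - t ^ 2 - 2 * s * t) / (2 * (1 - t)^2)"
      using exp_minus_sq_less[OF s(1)] assms by (simp add: s(2))
    also have "\<dots> = a * (ln t * t * (1 / (1 - t)^2)) + t / (1 - t) + 1 / 2"
    proof -
      have "t / (1 - t) = t * (1 - t) / (1 - t)^2" using assms by (simp add: power2_eq_square)
      moreover have "1 / 2 = (1 - t)^2 / (2 * (1 - t)^2)" using assms by simp
      ultimately have "a * (ln t * t * (1 / (1 - t)^2)) + t / (1 - t) + 1 / 2 =
          (2 * (ln t * t) + 2 * (t * (1 - t)) + (1 - t)^2) / (2 * (1 - t)^2)"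
        using True by (simp add: add_divide_distrib)
      also have "2 * (ln t * t) + 2 * (t * (1 - t)) + (1 - t)^2 = 1 - t ^ 2 - 2 * s * t"
        by (simp add: s_def algebra_simps power2_eq_square)
      finally show ?thesis ..
    qed
    finally show ?thesis using that sm by blast
  next
    case False
    define w where "w = t powr a"
    have wexp: "w = exp (- (a * s))" using assms by (simp add: w_def s_def powr_def)
    have "a * s > 0" using assms(1) s(1) by simp
    then have w: "0 < w" "w < 1" unfolding wexp by simp_all
    have "(\<lambda>n. (w ^ Suc n - t ^ Suc n) / (a - 1)) sums ((w / (1 - w) - t / (1 - t)) / (a - 1))"
      using assms w by (intro sums_divide sums_diff geometric_sums_Suc) auto
    moreover have "(w ^ Suc n - t ^ Suc n) / (a - 1) = t ^ Suc n * qlog a (t ^ Suc n)" for n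
    proof -
      let ?y = "t ^ Suc n"
      have "w ^ Suc n = ?y powr a"
        using assms by (simp add: w_def powr_realpow[symmetric] powr_powr mult.commute
            del: power_Suc)
      also have "\<dots> = ?y * ?y powr (a - 1)"
        using assms by (simp add: powr_diff del: power_Suc)
      finally show ?thesis using False by (simp add: qlog_def algebra_simps del: power_Suc)
    qed
    ultimately have sm: "(\<lambda>n. t ^ Suc n * qlog a (t ^ Suc n)) sums
        ((w / (1 - w) - t / (1 - t)) / (a - 1))" by simp
    define A B where "A = (1 + w) / (1 - w)" and "B = (1 + t) / (1 - t)"
    have AB: "w / (1 - w) = A / 2 - 1 / 2" "t / (1 - t) = B / 2 - 1 / 2"
      using w assms by (auto simp: A_def B_def field_simps)
    have "(a * A - B) / (a - 1) > 0"
    proof (cases "a > 1")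
      case True
      have "s * B < a * s * A"
        using coth_mult_strict_mono[of s "a * s"] s(1) True
        by (simp add: A_def B_def s(2) wexp[symmetric])
      then have "s * B < s * (a * A)" by (simp add: ac_simps)
      then show ?thesis using s(1) True by simp
    next
      case f: False
      have "a * s * A < s * B"
        using coth_mult_strict_mono[of "a * s" s] s(1) f False assms
        by (simp add: A_def B_def s(2) wexp[symmetric])
      then have "s * (a * A) < s * B" by (simp add: ac_simps)
      then show ?thesis using s(1) f False by (simp add: divide_neg_neg)
    qed
    moreover have "a * ((w / (1 - w) - t / (1 - t)) / (a - 1)) + t / (1 - t) + 1 / 2 =
        (a * A - B) / (a - 1) / 2"
    proof -
      have "a * A - B = (A - B) + (a - 1) * A" by (simp add: algebra_simps)
      then have "(a * A - B) / (a - 1) = (A - B) / (a - 1) + A"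
        using False by (simp only: add_divide_distrib) simp
      moreover have "w / (1 - w) - t / (1 - t) = (A - B) / 2" unfolding AB by simp
      then have "a * ((w / (1 - w) - t / (1 - t)) / (a - 1)) + t / (1 - t) + 1 / 2 =
          (A - B) / 2 / (a - 1) + (A - B) / 2 + (B / 2 - 1 / 2) + 1 / 2"
        by (simp only: mult_div_pred[OF False] AB(2))
      moreover have "\<dots> = ((A - B) / (a - 1) + A) / 2"
        by (simp add: add_divide_distrib diff_divide_distrib mult.commute)
      ultimately show ?thesis by (simp only:)
    qed
    ultimately have "0 < a * ((w / (1 - w) - t / (1 - t)) / (a - 1)) + t / (1 - t) + 1 / 2"
      by (simp only: half_gt_zero)
    then show ?thesis using that sm by blast
  qed
qed

section \<open>Log-concave sequences\<close>

text \<open>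
  At the first index \<open>k\<close> where \<open>q\<close> falls below the geometric sequence, the ratio \<open>q k / q (k - 1)\<close>
  is less than \<open>t\<close>. By log-concavity all later ratios are at most this one, so \<open>q\<close> stays below.
\<close>

lemma log_concave_crosses_geometric_once:
  fixes q :: "nat \<Rightarrow> real"
  assumes q0: "q 0 = 1" and nonneg: "\<And>n. 0 \<le> q n" and t: "0 < t"
    and lc: "\<And>k n. k \<le> n \<Longrightarrow> q k * q (Suc n) \<le> q (Suc k) * q n"
    and ex: "\<exists>n. q n < t ^ n"
  obtains k where "\<And>n. n < k \<Longrightarrow> t ^ n \<le> q n" "\<And>n. k \<le> n \<Longrightarrow> q n < t ^ n"
proof -
  define k where "k = (LEAST n. q n < t ^ n)"
  have k: "q k < t ^ k" unfolding k_def using ex by (rule LeastI_ex)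
  have below: "t ^ n \<le> q n" if "n < k" for n
    using not_less_Least[OF that[unfolded k_def]] by simp
  obtain j where j: "k = Suc j" using k q0 by (cases k) auto
  have qj: "t ^ j \<le> q j" using below j by simp
  have qj0: "0 < q j" using qj t by (smt (verit) zero_less_power)
  have "t * t ^ j \<le> t * q j" using qj t by simp
  then have step: "q k \<le> t * q j" using k j by simp
  have "q n < t ^ n" if "k \<le> n" for n
    using that
  proof (induction n rule: dec_induct)
    case (step n)
    have "q j * q (Suc n) \<le> q k * q n" using lc[of j n] step j by simp
    also have "\<dots> \<le> t * q j * q n"
      using \<open>q k \<le> t * q j\<close> nonneg by (intro mult_right_mono) auto
    finally have "q j * q (Suc n) \<le> q j * (t * q n)" by (simp add: ac_simps)
    then have "q (Suc n) \<le> t * q n" using qj0 by simp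
    also have "\<dots> < t * t ^ n" using step t by simp
    finally show ?case by simp
  qed (use k in simp)
  then show ?thesis using that below by blast
qed

text \<open>
  Among the log-concave sequences that start at 1 and have a given sum, the geometric one minimises
  the sum of the convex function \<open>x * qlog a x\<close>, so that the bound for geometric sequences carries
  over. The reason is the single crossing: \<open>q n - t ^ n\<close> is nonnegative before the index \<open>k\<close> and
  negative from \<open>k\<close> on, whereas the slope of the tangent at \<open>t ^ n\<close> decreases in \<open>n\<close>. Hence all
  these slopes may be replaced by the one at \<open>t ^ k\<close>, and with a constant slope the linear terms sum
  to 0. The same termwise lower bound gives convergence of the series, which for \<open>a \<le> 1\<close> does
  not follow from the convergence of \<open>\<Sum>n. q n\<close> alone.
\<close>

lemma one_sided_qlog_sum_bound:
  fixes q :: "nat \<Rightarrow> real"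
  assumes a: "a > 0"
    and q0: "q 0 = 1" and nonneg: "\<And>n. 0 \<le> q n" and le1: "\<And>n. q n \<le> 1"
    and lc: "\<And>k n. k \<le> n \<Longrightarrow> q k * q (Suc n) \<le> q (Suc k) * q n"
    and sm: "(\<lambda>n. q (Suc n)) sums S"
  obtains T where "((\<lambda>n. q (Suc n) * qlog a (q (Suc n))) has_sum T) UNIV" "0 < a * T + S + 1 / 2"
proof (cases "S = 0")
  case True
  have "q (Suc n) = 0" for n
    using suminf_eq_zero_iff[OF sums_summable[OF sm]] nonneg sums_unique[OF sm] True by simp
  then show ?thesis using that[of 0] True by simp
next
  case False
  let ?\<phi> = "\<lambda>x. x * qlog a x"
  have "S \<ge> 0" using sums_le[OF _ sums_zero sm] nonneg by simp
  then have S: "S > 0" using False by simp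
  \<comment> \<open>The ratio for which the geometric sequence, without its first term, has the sum \<open>S\<close>.\<close>
  define t where "t = S / (1 + S)"
  have "1 - t = 1 / (1 + S)" using S by (simp add: t_def field_simps)
  then have t: "0 < t" "t < 1" "t / (1 - t) = S" using S by (simp_all add: t_def)
  obtain L where L: "(\<lambda>n. ?\<phi> (t ^ Suc n)) sums L" "0 < a * L + S + 1 / 2"
    using geometric_qlog_sum_bound[OF a t(1,2)] unfolding t(3) by blast
  have "(\<lambda>n. t ^ Suc n) sums S" using geometric_sums_Suc[of t] t(1,2) unfolding t(3) by simp
  from sums_diff[OF sm this] have diff: "(\<lambda>n. q (Suc n) - t ^ Suc n) sums 0" by simp
  \<comment> \<open>\<open>c\<close> is the common slope.\<close>
  obtain c where c: "?\<phi> (t ^ Suc n) + c * (q (Suc n) - t ^ Suc n) \<le> ?\<phi> (q (Suc n))" for n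
  proof (cases "\<exists>n. q n < t ^ n")
    case True
    obtain k where k: "\<And>n. n < k \<Longrightarrow> t ^ n \<le> q n" "\<And>n. k \<le> n \<Longrightarrow> q n < t ^ n"
      using log_concave_crosses_geometric_once[OF q0 nonneg t(1) lc True] by blast
    have "(a * qlog a (t ^ k) + 1) * (q n - t ^ n) \<le> (a * qlog a (t ^ n) + 1) * (q n - t ^ n)" for n
    proof (cases "n < k")
      case True
      then have "t ^ k \<le> t ^ n" using t by (intro power_decreasing) auto
      then have "qlog a (t ^ k) \<le> qlog a (t ^ n)" using t by (intro qlog_mono) auto
      then show ?thesis using k(1)[OF True] a by (intro mult_right_mono) auto
    next
      case False
      then have "t ^ n \<le> t ^ k" using t by (intro power_decreasing) auto
      then have "qlog a (t ^ n) \<le> qlog a (t ^ k)" using t by (intro qlog_mono) auto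
      then show ?thesis using k(2)[of n] False a by (intro mult_right_mono_neg) auto
    qed
    moreover have "?\<phi> (t ^ n) + (a * qlog a (t ^ n) + 1) * (q n - t ^ n) \<le> ?\<phi> (q n)" for n
      using mult_qlog_above_tangent[OF a nonneg, of "t ^ n" n] t by simp
    ultimately have "?\<phi> (t ^ n) + (a * qlog a (t ^ k) + 1) * (q n - t ^ n) \<le> ?\<phi> (q n)" for n
      by (rule order_trans[OF add_left_mono])
    then show ?thesis using that by blast
  next
    case False
    \<comment> \<open>Without a crossing \<open>q\<close> dominates a sequence of the same sum, so the two sequences are equal.\<close>
    then have ge: "0 \<le> q (Suc n) - t ^ Suc n" for n by (simp add: not_less del: power_Suc)
    have "q (Suc n) - t ^ Suc n = 0" for n
      using suminf_eq_zero_iff[OF sums_summable[OF diff] ge] sums_unique[OF diff] by simp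
    then have "q (Suc n) = t ^ Suc n" for n by (simp del: power_Suc)
    then show ?thesis using that[of 0] by simp
  qed
  have lower: "(\<lambda>n. ?\<phi> (t ^ Suc n) + c * (q (Suc n) - t ^ Suc n)) sums L"
    using sums_add[OF L(1) sums_mult[OF diff, of c]] by simp
  have nonpos: "?\<phi> (q (Suc n)) \<le> 0" for n
    using qlog_mono[of "q (Suc n)" 1 a] nonneg[of "Suc n"] le1[of "Suc n"]
    by (cases "q (Suc n) = 0") (auto intro: mult_nonneg_nonpos)
  have abs: "summable (\<lambda>n. norm (?\<phi> (q (Suc n))))"
  proof (rule summable_comparison_test')
    show "summable (\<lambda>n. - (?\<phi> (t ^ Suc n) + c * (q (Suc n) - t ^ Suc n)))"
      using sums_minus[OF lower] by (rule sums_summable)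
    fix n :: nat assume "0 \<le> n"
    show "norm (norm (?\<phi> (q (Suc n)))) \<le> - (?\<phi> (t ^ Suc n) + c * (q (Suc n) - t ^ Suc n))"
      using c[of n] nonpos[of n] by simp
  qed
  then have s: "(\<lambda>n. ?\<phi> (q (Suc n))) sums (\<Sum>n. ?\<phi> (q (Suc n)))"
    by (intro summable_sums summable_norm_cancel[where f = "\<lambda>n. ?\<phi> (q (Suc n))"])
  have "L \<le> (\<Sum>n. ?\<phi> (q (Suc n)))" using sums_le[OF c lower s] .
  then have "a * L \<le> a * (\<Sum>n. ?\<phi> (q (Suc n)))" using a by simp
  then show ?thesis using that[OF norm_summable_imp_has_sum[OF abs s]] L(2) by linarith
qed

lemma has_sum_int_split:
  fixes f :: "int \<Rightarrow> real"
  assumes "((\<lambda>n. f (k + int (Suc n))) has_sum A) UNIV"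
    and "((\<lambda>n. f (k - int (Suc n))) has_sum B) UNIV"
  shows "(f has_sum (f k + A + B)) UNIV"
proof -
  have 1: "(f has_sum A) {k<..}"
    using assms(1) by (subst (asm) has_sum_reindex_bij_betw
      [where A = UNIV and B = "{k<..}" and g = "\<lambda>n. k + int (Suc n)"])
      (auto intro!: bij_betwI[where g = "\<lambda>m. nat (m - k - 1)"])
  have 2: "(f has_sum B) {..<k}"
    using assms(2) by (subst (asm) has_sum_reindex_bij_betw
      [where A = UNIV and B = "{..<k}" and g = "\<lambda>n. k - int (Suc n)"])
      (auto intro!: bij_betwI[where g = "\<lambda>m. nat (k - m - 1)"])
  have 3: "(f has_sum (f k + A)) ({k} \<union> {k<..})"
    by (intro has_sum_Un_disjoint 1 has_sum_finiteI) auto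
  have "(f has_sum (f k + A + B)) (({k} \<union> {k<..}) \<union> {..<k})"
    by (rule has_sum_Un_disjoint[OF 3 2]) auto
  moreover have "({k} \<union> {k<..}) \<union> {..<k} = UNIV" by auto
  ultimately show ?thesis by simp
qed

text \<open>
  Log-concavity is required for all symmetric configurations \<open>x \<le> x + d, x + e \<le> x + d + e\<close>. This
  form includes that the support is an interval, and it is the one that
  autocorrelation preserves.
\<close>

locale log_concave_pmf =
  fixes p :: "int \<Rightarrow> real"
  assumes nonneg: "p n \<ge> 0"
    and has_sum_1: "(p has_sum 1) UNIV"
    and log_concave: "0 \<le> d \<Longrightarrow> 0 \<le> e \<Longrightarrow> p x * p (x + d + e) \<le> p (x + d) * p (x + e)"
begin

lemma maximum_exists: obtains k where "p k > 0" "\<And>n. p n \<le> p k"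
proof -
  have "\<exists>n. p n \<noteq> 0"
  proof (rule ccontr)
    assume "\<nexists>n. p n \<noteq> 0"
    then have "(p has_sum 0) UNIV" by (simp add: has_sum_0)
    then show False using has_sum_unique[OF has_sum_1] by fastforce
  qed
  then obtain i where i: "p i > 0" using nonneg by (metis less_eq_real_def)
  obtain F where F: "finite F" "dist (sum p F) 1 \<le> p i / 2"
    using has_sum_finite_approximation[OF has_sum_1, of "p i / 2"] i by auto
  have out: "p n \<le> p i" if "n \<notin> F" for n
  proof -
    have "p n + sum p F \<le> 1"
      using finite_sum_le_has_sum[OF has_sum_1, of "insert n F"] F(1) that nonneg by simp
    then show ?thesis using F(2) i unfolding dist_real_def by linarith
  qed
  have "Max (p ` insert i F) \<in> p ` insert i F" using F(1) by (intro Max_in) auto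
  then obtain k where k: "p k = Max (p ` insert i F)" by force
  have "p n \<le> p k" if "n \<in> insert i F" for n
    unfolding k using F(1) that by (intro Max_ge) auto
  then have "p n \<le> p k" for n using out[of n] by (meson insertCI order_trans)
  then show ?thesis using that i by (metis order_less_le_trans)
qed

text \<open>
  Equivalently, the entropy of order \<open>a\<close> exceeds the entropy of order \<open>\<infinity>\<close>, which is \<open>- ln (p k)\<close>, by
  less than \<open>ln a / (a - 1)\<close> (by less than 1 if \<open>a = 1\<close>). After dividing by the maximum \<open>p k\<close>, the
  sequence splits at \<open>k\<close> into two log-concave sequences that start at 1, and the one-sided bounds add
  up; each receives half of the central term.
\<close>

lemma qlog_sum_bound:
  assumes a: "a > 0" and k: "p k > 0" "\<And>n. p n \<le> p k"
  obtains T where "((\<lambda>n. p n * qlog a (p n)) has_sum T) UNIV"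
    "qlog a (p k) - p k powr (a - 1) / a < T"
proof -
  let ?\<phi> = "\<lambda>x. x * qlog a x"
  define q where "q n = p n / p k" for n
  have q: "0 \<le> q n" "q n \<le> 1" "q k = 1" for n using k nonneg by (auto simp: q_def)
  have qlc: "q x * q (x + d + e) \<le> q (x + d) * q (x + e)" if "0 \<le> d" "0 \<le> e" for x d e
    using log_concave[OF that] k(1) by (simp add: q_def divide_right_mono)
  have hq: "(q has_sum (1 / p k)) UNIV"
    using has_sum_cmult_left[OF has_sum_1, of "1 / p k"] by (simp add: q_def[abs_def])
  have summ: "q summable_on UNIV" using hq by (rule has_sum_imp_summable)
  define R where "R = infsum (\<lambda>n. q (k + int (Suc n))) UNIV"
  define L where "L = infsum (\<lambda>n. q (k - int (Suc n))) UNIV"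
  have "(\<lambda>n. q (k + int (Suc n))) summable_on UNIV"
    using summable_on_reindex[of "\<lambda>n. k + int (Suc n)" UNIV q] summable_on_subset_banach[OF summ]
    by (simp add: inj_on_def o_def)
  then have R: "((\<lambda>n. q (k + int (Suc n))) has_sum R) UNIV" by (simp add: R_def)
  have "(\<lambda>n. q (k - int (Suc n))) summable_on UNIV"
    using summable_on_reindex[of "\<lambda>n. k - int (Suc n)" UNIV q] summable_on_subset_banach[OF summ]
    by (simp add: inj_on_def o_def)
  then have L: "((\<lambda>n. q (k - int (Suc n))) has_sum L) UNIV" by (simp add: L_def)
  have mass: "1 + R + L = 1 / p k"
    using has_sum_unique[OF has_sum_int_split[OF R L] hq] q by simp
  have right: "q (k + int j) * q (k + int (Suc n)) \<le> q (k + int (Suc j)) * q (k + int n)"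
    if "j \<le> n" for j n
    using qlc[of 1 "int n - int j" "k + int j"] that by (simp add: algebra_simps)
  have left: "q (k - int j) * q (k - int (Suc n)) \<le> q (k - int (Suc j)) * q (k - int n)"
    if "j \<le> n" for j n
    using qlc[of 1 "int n - int j" "k - int (Suc n)"] that by (simp add: algebra_simps)
  obtain A where A: "((\<lambda>n. ?\<phi> (q (k + int (Suc n)))) has_sum A) UNIV" "0 < a * A + R + 1 / 2"
    using one_sided_qlog_sum_bound[of a "\<lambda>n. q (k + int n)", OF a _ _ _ right has_sum_imp_sums[OF R]]
      q by auto
  obtain B where B: "((\<lambda>n. ?\<phi> (q (k - int (Suc n)))) has_sum B) UNIV" "0 < a * B + L + 1 / 2"
    using one_sided_qlog_sum_bound[of a "\<lambda>n. q (k - int n)", OF a _ _ _ left has_sum_imp_sums[OF L]]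
      q by auto
  have "((\<lambda>n. ?\<phi> (q n)) has_sum (?\<phi> (q k) + A + B)) UNIV"
    using A(1) B(1) by (rule has_sum_int_split)
  then have "((\<lambda>n. ?\<phi> (q n)) has_sum (A + B)) UNIV" using q by simp
  then have "((\<lambda>n. qlog a (p k) * p n + p k powr a * ?\<phi> (q n)) has_sum
      (qlog a (p k) * 1 + p k powr a * (A + B))) UNIV"
    by (intro has_sum_add has_sum_cmult_right has_sum_1)
  moreover have "qlog a (p k) * p n + p k powr a * ?\<phi> (q n) = ?\<phi> (p n)" for n
  proof (cases "p n = 0")
    case False
    then have qn: "q n > 0" using k nonneg[of n] by (simp add: q_def less_le)
    have pn: "p n = p k * q n" using k by (simp add: q_def)
    have "p k powr a = p k * p k powr (a - 1)" using k by (simp add: powr_diff)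
    then show ?thesis unfolding pn qlog_mult[OF k(1) qn] by (simp add: algebra_simps)
  qed (simp add: q_def)
  ultimately have "((\<lambda>n. ?\<phi> (p n)) has_sum (qlog a (p k) + p k powr a * (A + B))) UNIV" by simp
  moreover have "qlog a (p k) - p k powr (a - 1) / a < qlog a (p k) + p k powr a * (A + B)"
  proof -
    have "- (1 / p k) < a * (A + B)" using A(2) B(2) mass by (simp add: algebra_simps)
    then have "- (1 / p k) / a < A + B"
      unfolding pos_divide_less_eq[OF a] by (simp only: mult.commute)
    then have "p k powr a * (- (1 / p k) / a) < p k powr a * (A + B)"
      using k by (intro mult_strict_left_mono) auto
    then show ?thesis using k by (simp add: powr_diff)
  qed
  ultimately show ?thesis using that by blast
qed

end

section \<open>Comparing entropies of different orders\<close>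

context log_concave_pmf
begin

lemma qlog_sum_le:
  assumes T: "((\<lambda>n. p n * qlog a (p n)) has_sum T) UNIV"
    and bound: "\<And>n. p n > 0 \<Longrightarrow> qlog a (p n) \<le> c + s * p n"
    and sq: "((\<lambda>n. (p n)\<^sup>2) has_sum Q) UNIV"
  shows "T \<le> c + s * Q"
proof (rule has_sum_mono[OF T])
  show "((\<lambda>n. c * p n + s * (p n)\<^sup>2) has_sum (c + s * Q)) UNIV"
    using has_sum_add[OF has_sum_cmult_right[OF has_sum_1, of c] has_sum_cmult_right[OF sq, of s]]
    by simp
  fix n
  show "p n * qlog a (p n) \<le> c * p n + s * (p n)\<^sup>2"
  proof (cases "p n > 0")
    case True
    then have "p n * qlog a (p n) \<le> p n * (c + s * p n)"
      using bound[OF True] by (intro mult_left_mono) auto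
    then show ?thesis by (simp add: algebra_simps power2_eq_square)
  next
    case False
    then have "p n = 0" using nonneg[of n] by simp
    then show ?thesis by simp
  qed
qed

text \<open>
  \<open>Q\<close> is the collision probability, so this says that for \<open>a \<le> 2\<close> the entropy of order \<open>a\<close> is at
  least that of order 2. It is Jensen's inequality, with the tangent of \<open>qlog a\<close> taken at \<open>Q\<close>: the
  mean of \<open>p n\<close> under \<open>p\<close> itself is \<open>Q\<close>.
\<close>

lemma qlog_sum_le_qlog_collision:
  assumes "a \<le> 2" and T: "((\<lambda>n. p n * qlog a (p n)) has_sum T) UNIV"
    and sq: "((\<lambda>n. (p n)\<^sup>2) has_sum Q) UNIV" and Q: "Q > 0"
  shows "T \<le> qlog a Q"
proof -
  have "T \<le> (qlog a Q - Q powr (a - 1)) + Q powr (a - 1) / Q * Q"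
  proof (rule qlog_sum_le[OF T _ sq])
    fix n assume n: "p n > 0"
    have "qlog a (p n) = qlog a Q + Q powr (a - 1) * qlog a (p n / Q)"
      using qlog_mult[OF Q, of "p n / Q" a] n Q by simp
    also have "\<dots> \<le> qlog a Q + Q powr (a - 1) * (p n / Q - 1)"
      using n Q assms(1) by (intro add_left_mono mult_left_mono qlog_le_minus_one) auto
    finally show "qlog a (p n) \<le> (qlog a Q - Q powr (a - 1)) + Q powr (a - 1) / Q * p n"
      by (simp add: algebra_simps)
  qed
  then show ?thesis using Q by simp
qed

lemma qlog_sum_le_qlog_bound:
  assumes T: "((\<lambda>n. p n * qlog a (p n)) has_sum T) UNIV"
    and sq: "((\<lambda>n. (p n)\<^sup>2) has_sum Q) UNIV" and m: "\<And>n. p n \<le> m"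
  shows "T \<le> qlog a m"
  using qlog_sum_le[OF T _ sq, of "qlog a m" 0] m by (simp add: qlog_mono)

text \<open>
  The case \<open>a = 2\<close> of the bound on \<open>\<Sum>n. p n * qlog a (p n)\<close>, since
  \<open>p n * qlog 2 (p n) = (p n)\<^sup>2 - p n\<close>.
\<close>

lemma half_maximum_less_collision:
  assumes sq: "((\<lambda>n. (p n)\<^sup>2) has_sum Q) UNIV" and k: "p k > 0" "\<And>n. p n \<le> p k"
  shows "p k < 2 * Q"
proof -
  obtain T where T: "((\<lambda>n. p n * qlog 2 (p n)) has_sum T) UNIV"
    "qlog 2 (p k) - p k powr (2 - 1) / 2 < T"
    using qlog_sum_bound[OF _ k, of 2] by auto
  have "p n * qlog 2 (p n) = (p n)\<^sup>2 + (- 1) * p n" for n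
    using nonneg[of n] by (simp add: qlog_def algebra_simps power2_eq_square)
  then have "((\<lambda>n. p n * qlog 2 (p n)) has_sum (Q + (- 1) * 1)) UNIV"
    by (simp only: has_sum_add[OF sq has_sum_cmult_right[OF has_sum_1, of "- 1"]])
  then have "T = Q - 1" using has_sum_unique[OF T(1)] by simp
  then show ?thesis using T(2) k by (simp add: qlog_def)
qed

text \<open>
  The entropy of every finite order is \<open>- log b v\<close> for an effective probability \<open>v\<close>, the mean of the
  \<open>p n\<close> with respect to the deformed logarithm. As \<open>qlog a\<close> is strictly increasing, comparing
  entropies amounts to comparing sums of \<open>p n * qlog a (p n)\<close>, without distinguishing the sign of
  \<open>1 - a\<close>.
\<close>

lemma renyi_entropy_eq_log:
  assumes p: "p = mass M X" and a: "a > 0"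
    and T: "((\<lambda>n. p n * qlog a (p n)) has_sum T) UNIV"
  obtains v where "v > 0" "qlog a v = T" "renyi_entropy b (ereal a) M X = ereal (- log b v)"
proof (cases "a = 1")
  case True
  have "((\<lambda>n. p n * qlog a (p n) * (1 / ln b)) has_sum (T * (1 / ln b))) UNIV"
    by (rule has_sum_cmult_left[OF T])
  then have "((\<lambda>n. p n * log b (p n)) has_sum log b (exp T)) UNIV"
    by (simp add: True qlog_def log_def)
  then have "((\<lambda>n. p n * log b (p n)) has_sum log b (exp T)) {n. p n > 0}"
    using nonneg by (subst has_sum_cong_neutral[where T = UNIV]) (auto simp: less_le)
  then have "renyi_entropy b (ereal a) M X = ereal (- log b (exp T))"
    by (simp add: renyi_entropy_def True p[symmetric] one_ereal_def[symmetric] has_sum_iff)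
  then show ?thesis using that[of "exp T"] True by (simp add: qlog_def)
next
  case False
  define P where "P = 1 + (a - 1) * T"
  have "((\<lambda>n. p n + (a - 1) * (p n * qlog a (p n))) has_sum P) UNIV"
    unfolding P_def by (intro has_sum_add has_sum_1 has_sum_cmult_right T)
  moreover have "p n + (a - 1) * (p n * qlog a (p n)) = p n powr a" for n
  proof (cases "p n = 0")
    case nz: False
    have eq: "(a - 1) * qlog a (p n) = p n powr (a - 1) - 1" using False by (simp add: qlog_def)
    have "p n + p n * ((a - 1) * qlog a (p n)) = p n * p n powr (a - 1)"
      unfolding eq by (simp add: algebra_simps)
    then show ?thesis using nz nonneg[of n] by (simp add: powr_diff mult.left_commute)
  qed (use a in simp)
  ultimately have hs: "((\<lambda>n. p n powr a) has_sum P) UNIV" by simp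
  obtain k where k: "p k > 0" using maximum_exists by blast
  have "p k powr a \<le> P" using finite_sum_le_has_sum[OF hs, of "{k}"] by simp
  moreover have "p k powr a > 0" using k by simp
  ultimately have P: "P > 0" by linarith
  define v where "v = P powr (1 / (a - 1))"
  have "((\<lambda>n. p n powr a) has_sum P) {n. p n > 0}"
    using hs nonneg a by (subst has_sum_cong_neutral[where T = UNIV]) (auto simp: less_le)
  then have "renyi_entropy b (ereal a) M X = ereal (1 / (1 - a) * log b P)"
    using False by (simp add: renyi_entropy_def p[symmetric] has_sum_iff one_ereal_def)
  also have "1 / (1 - a) * log b P = - log b v"
    using P minus_divide_right[of "log b P" "a - 1"] by (simp add: v_def log_powr)
  finally have "renyi_entropy b (ereal a) M X = ereal (- log b v)" .
  moreover have "qlog a v = T" using P False by (simp add: v_def qlog_def powr_powr P_def)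
  moreover have "v > 0" using P by (simp add: v_def)
  ultimately show ?thesis using that by blast
qed

lemma renyi_entropy_infinity:
  assumes p: "p = mass M X" and k: "\<And>n. p n \<le> p k"
  shows "renyi_entropy b \<infinity> M X = ereal (- log b (p k))"
proof -
  have "(SUP n. p n) = p k" using k by (intro cSup_eq_maximum) auto
  then show ?thesis by (simp add: renyi_entropy_def p[symmetric])
qed

end

lemma alpha_pow_pos: "a > 0 \<Longrightarrow> alpha_pow (ereal a) > 0"
  by (simp add: alpha_pow_def)

lemma qlog_divide_alpha_pow:
  assumes "a > 0" "m > 0"
  shows "qlog a (m / alpha_pow (ereal a)) = qlog a m - m powr (a - 1) / a"
proof -
  have "qlog a (1 / alpha_pow (ereal a)) = - 1 / a"
  proof (cases "a = 1")
    case True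
    then show ?thesis by (simp add: alpha_pow_def qlog_def one_ereal_def ln_div)
  next
    case False
    then have "(1 / alpha_pow (ereal a)) powr (a - 1) = 1 / a"
      using assms by (simp add: alpha_pow_def one_ereal_def powr_divide powr_powr)
    moreover have "(1 / a - 1) / (a - 1) = - 1 / a" using assms False by (simp add: field_simps)
    ultimately show ?thesis using False by (simp add: qlog_def)
  qed
  then show ?thesis
    using qlog_mult[OF assms(2), of "1 / alpha_pow (ereal a)" a] alpha_pow_pos[OF assms(1)]
    by simp
qed

section \<open>The difference of two independent copies\<close>

text \<open>
  \<open>r\<close> is the mass function of the difference of two independent variables with mass function \<open>p\<close>.
\<close>

locale log_concave_difference = log_concave_pmf p for p :: "int \<Rightarrow> real" +
  fixes r :: "int \<Rightarrow> real"
  assumes autocorrelation: "((\<lambda>m. p (m + n) * p m) has_sum r n) UNIV"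
    and difference_has_sum_1: "(r has_sum 1) UNIV"
begin

lemma shifted_autocorrelation: "((\<lambda>m. p (m + i) * p (m + j)) has_sum r (i - j)) UNIV"
proof -
  have "bij_betw (\<lambda>m. m + j) UNIV (UNIV :: int set)"
    by (rule bij_betwI[where g = "\<lambda>m. m - j"]) auto
  from has_sum_reindex_bij_betw[OF this, of "\<lambda>m. p (m + (i - j)) * p m"] autocorrelation[of "i - j"]
  show ?thesis by (simp add: algebra_simps)
qed

lemma collision: "((\<lambda>n. (p n)\<^sup>2) has_sum r 0) UNIV"
  using autocorrelation[of 0] by (simp add: power2_eq_square)

lemma difference_symmetric: "r (- n) = r n"
  using has_sum_unique[OF shifted_autocorrelation[of 0 n]] shifted_autocorrelation[of n 0]
  by (simp add: mult.commute)

text \<open>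
  A minor of the infinite matrix with the entry \<open>p (m + i)\<close> in row \<open>i\<close> and column \<open>m\<close>: log-concavity
  of \<open>p\<close> says that all minors of order 2 have this sign.
\<close>

lemma minor_nonneg:
  assumes "j \<le> i" "m \<le> m'"
  shows "0 \<le> p (m + i) * p (m' + j) - p (m' + i) * p (m + j)"
  using log_concave[of "i - j" "m' - m" "m + j"] assms by (simp add: algebra_simps)

text \<open>
  The Cauchy-Binet formula: \<open>r (i - j)\<close> is the inner product of rows \<open>i\<close> and \<open>j\<close> of the matrix with
  entries \<open>p (m + i)\<close>. Twice the minor \<open>r (a - e) * r b - r (b - e) * r a\<close> is the sum over all pairs
  \<open>(m, m')\<close> of products of two minors of this matrix. Both factors change their sign when
  \<open>m\<close> and \<open>m'\<close> are exchanged, so every product is nonnegative. The sum is evaluated first over \<open>m\<close>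
  and then over \<open>m'\<close>.
\<close>

lemma difference_log_concave:
  assumes "0 \<le> d" "0 \<le> e"
  shows "r x * r (x + d + e) \<le> r (x + d) * r (x + e)"
proof -
  define a b where "a = x + d + e" and "b = x + e"
  have ab: "b \<le> a" using assms by (simp add: a_def b_def)
  have pointwise: "0 \<le> (p (m + a) * p (m' + b) - p (m' + a) * p (m + b)) *
      (p (m + e) * p (m' + 0) - p (m' + e) * p (m + 0))" for m m'
  proof (cases "m \<le> m'")
    case True
    then show ?thesis using minor_nonneg[OF ab] minor_nonneg[OF assms(2)]
      by (intro mult_nonneg_nonneg)
  next
    case False
    then have "m' \<le> m" by simp
    then show ?thesis
      using minor_nonneg[OF ab \<open>m' \<le> m\<close>] minor_nonneg[OF assms(2) \<open>m' \<le> m\<close>]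
      by (intro mult_nonpos_nonpos) auto
  qed
  have inner: "0 \<le> r (a - e) * (p (m' + b) * p (m' + 0)) + (- r (a - 0)) * (p (m' + b) * p (m' + e))
      + (- r (b - e)) * (p (m' + a) * p (m' + 0)) + r (b - 0) * (p (m' + a) * p (m' + e))"
    (is "0 \<le> ?I m'") for m'
  proof -
    let ?f = "\<lambda>m. (p (m' + b) * p (m' + 0)) * (p (m + a) * p (m + e))
      + (- (p (m' + b) * p (m' + e))) * (p (m + a) * p (m + 0))
      + (- (p (m' + a) * p (m' + 0))) * (p (m + b) * p (m + e))
      + (p (m' + a) * p (m' + e)) * (p (m + b) * p (m + 0))"
    have "(?f has_sum ((p (m' + b) * p (m' + 0)) * r (a - e)
      + (- (p (m' + b) * p (m' + e))) * r (a - 0)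
      + (- (p (m' + a) * p (m' + 0))) * r (b - e)
      + (p (m' + a) * p (m' + e)) * r (b - 0))) UNIV"
      by (intro has_sum_add has_sum_cmult_right shifted_autocorrelation)
    moreover have "0 \<le> ?f m" for m using pointwise[of m m'] by (simp add: algebra_simps)
    ultimately have "0 \<le> (p (m' + b) * p (m' + 0)) * r (a - e)
      + (- (p (m' + b) * p (m' + e))) * r (a - 0)
      + (- (p (m' + a) * p (m' + 0))) * r (b - e)
      + (p (m' + a) * p (m' + e)) * r (b - 0)" by (rule has_sum_nonneg)
    then show ?thesis by (simp add: algebra_simps)
  qed
  have "(?I has_sum (r (a - e) * r (b - 0) + (- r (a - 0)) * r (b - e)
      + (- r (b - e)) * r (a - 0) + r (b - 0) * r (a - e))) UNIV"
    by (intro has_sum_add has_sum_cmult_right shifted_autocorrelation)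
  from has_sum_nonneg[OF this inner] have "r (b - e) * r a \<le> r (a - e) * r b"
    by (simp add: algebra_simps)
  then show ?thesis by (simp add: a_def b_def ac_simps)
qed

sublocale difference: log_concave_pmf r
proof
  show "0 \<le> r n" for n
    using has_sum_nonneg[OF autocorrelation[of n]] nonneg by simp
qed (rule difference_has_sum_1 difference_log_concave; assumption)+

lemma difference_le_0: "r n \<le> r 0"
proof -
  have "r (- \<bar>n\<bar>) * r \<bar>n\<bar> \<le> r 0 * r 0"
    using difference_log_concave[of "\<bar>n\<bar>" "\<bar>n\<bar>" "- \<bar>n\<bar>"] by simp
  then have "(r \<bar>n\<bar>)\<^sup>2 \<le> (r 0)\<^sup>2" by (simp add: difference_symmetric power2_eq_square)
  then have "r \<bar>n\<bar> \<le> r 0" using difference.nonneg[of 0] by (rule power2_le_imp_le)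
  then show ?thesis using difference_symmetric[of n] by (cases "n \<ge> 0") auto
qed

lemma difference_0_pos: "r 0 > 0"
  using difference.maximum_exists difference_le_0 by (metis order_less_le_trans)

text \<open>
  Let \<open>v\<close> and \<open>w\<close> be the effective probabilities of \<open>X\<close> and \<open>Z\<close>, so that the claim reads
  \<open>v < c_const \<alpha> * w\<close>. The maximum of \<open>r\<close> is the collision probability \<open>r 0\<close> of \<open>p\<close>. This gives
  \<open>r 0 < alpha_pow \<alpha> * w\<close> for finite \<open>\<alpha>\<close> and \<open>w = r 0\<close> for \<open>\<alpha> = \<infinity>\<close>. On the other side,
  \<open>v \<le> r 0\<close> for \<open>\<alpha> \<le> 2\<close>, and \<open>v \<le> p k < 2 * r 0\<close> for \<open>\<alpha> > 2\<close>, where \<open>p k\<close> is the maximum of \<open>p\<close>;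
  this is where the factor 2 comes from.
\<close>

lemma renyi_entropy_difference:
  assumes p: "p = mass M X" and r: "r = mass M Z" and b: "b > 1" and \<alpha>: "0 < \<alpha>"
  shows "renyi_entropy b \<alpha> M Z - renyi_entropy b \<alpha> M X < ereal (log b (c_const \<alpha>))"
proof -
  obtain k where k: "p k > 0" "\<And>n. p n \<le> p k" using maximum_exists by blast
  have half: "p k < 2 * r 0" using half_maximum_less_collision[OF collision k] .
  obtain v w where vw: "v > 0" "w > 0" "v < c_const \<alpha> * w"
    "renyi_entropy b \<alpha> M X = ereal (- log b v)" "renyi_entropy b \<alpha> M Z = ereal (- log b w)"
  proof (cases "\<alpha> = \<infinity>")
    case True
    show ?thesis
    proof (rule that)
      show "renyi_entropy b \<alpha> M X = ereal (- log b (p k))"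
        using renyi_entropy_infinity[OF p k(2)] True by simp
      show "renyi_entropy b \<alpha> M Z = ereal (- log b (r 0))"
        using difference.renyi_entropy_infinity[OF r difference_le_0] True by simp
      show "p k < c_const \<alpha> * r 0" using half True by (simp add: c_const_def alpha_pow_def)
    qed (use k difference_0_pos in auto)
  next
    case False
    then obtain a where a: "\<alpha> = ereal a" "a > 0" using \<alpha> by (cases \<alpha>) auto
    let ?A = "alpha_pow (ereal a)"
    have A: "?A > 0" using a(2) by (rule alpha_pow_pos)
    obtain T where T: "((\<lambda>n. p n * qlog a (p n)) has_sum T) UNIV"
      using qlog_sum_bound[OF a(2) k] by blast
    obtain v where v: "v > 0" "qlog a v = T" "renyi_entropy b (ereal a) M X = ereal (- log b v)"
      using renyi_entropy_eq_log[OF p a(2) T] by blast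
    obtain U where U: "((\<lambda>n. r n * qlog a (r n)) has_sum U) UNIV"
      "qlog a (r 0) - r 0 powr (a - 1) / a < U"
      using difference.qlog_sum_bound[OF a(2) difference_0_pos difference_le_0] by blast
    obtain w where w: "w > 0" "qlog a w = U" "renyi_entropy b (ereal a) M Z = ereal (- log b w)"
      using difference.renyi_entropy_eq_log[OF r a(2) U(1)] by blast
    have "qlog a (r 0 / ?A) < qlog a w"
      using U(2) w(2) qlog_divide_alpha_pow[OF a(2) difference_0_pos] by simp
    then have "r 0 / ?A < w" using qlog_less_iff[of "r 0 / ?A" w a] A difference_0_pos w(1) by simp
    then have rw: "r 0 < ?A * w" using A by (simp add: pos_divide_less_eq mult.commute)
    have "v < c_const \<alpha> * w"
    proof (cases "a > 2")
      case True
      have "\<not> qlog a (p k) < qlog a v"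
        using qlog_sum_le_qlog_bound[OF T collision k(2)] v(2) by simp
      then have "v \<le> p k" using qlog_less_iff[of "p k" v a] k(1) v(1) by simp
      then have "v < 2 * (?A * w)" using half rw by linarith
      then show ?thesis using True a(1) by (simp add: c_const_def)
    next
      case False
      have "\<not> qlog a (r 0) < qlog a v"
        using qlog_sum_le_qlog_collision[OF _ T collision difference_0_pos] v(2) False by simp
      then have "v \<le> r 0" using qlog_less_iff[of "r 0" v a] difference_0_pos v(1) by simp
      then have "v < ?A * w" using rw by linarith
      then show ?thesis using False a(1) by (simp add: c_const_def)
    qed
    then show ?thesis using that[OF v(1) w(1)] v(3) w(3) a(1) by simp
  qed
  have "0 < c_const \<alpha> * w" using vw by linarith
  then have c: "c_const \<alpha> > 0" using vw(2) by (simp add: zero_less_mult_iff)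
  have "log b v < log b (c_const \<alpha> * w)" using vw b by simp
  also have "\<dots> = log b (c_const \<alpha>) + log b w" using c vw(2) b by (simp add: log_mult)
  finally show ?thesis unfolding vw(4,5) by simp
qed

end

section \<open>Random variables\<close>

lemma (in prob_space) has_sum_prob_int:
  fixes Z :: "'a \<Rightarrow> int"
  assumes Z: "Z \<in> measurable M (count_space UNIV)" and E: "E \<in> events"
  shows "((\<lambda>m. prob (E \<inter> (Z -` {m} \<inter> space M))) has_sum prob E) UNIV"
proof -
  let ?F = "\<lambda>m. E \<inter> (Z -` {m} \<inter> space M)"
  have "(\<lambda>i. prob (?F (int_decode i))) sums prob (\<Union>i. ?F (int_decode i))"
  proof (rule finite_measure_UNION)
    show "range (\<lambda>i. ?F (int_decode i)) \<subseteq> events"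
      using Z E by (auto intro!: sets.Int measurable_sets)
    show "disjoint_family (\<lambda>i. ?F (int_decode i))"
      by (auto simp: disjoint_family_on_def int_decode_eq)
  qed
  moreover have "(\<Union>i. ?F (int_decode i)) = E"
  proof -
    have "(\<Union>i. ?F (int_decode i)) = (\<Union>m\<in>range int_decode. ?F m)" by simp
    also have "\<dots> = E"
      unfolding bij_is_surj[OF bij_int_decode] using sets.sets_into_space[OF E] by auto
    finally show ?thesis .
  qed
  ultimately have "((\<lambda>i. prob (?F (int_decode i))) has_sum prob E) UNIV"
    by (intro sums_nonneg_imp_has_sum) auto
  then show ?thesis
    using has_sum_reindex_bij_betw[OF bij_int_decode, of "\<lambda>m. prob (?F m)"] by simp
qed

text \<open>
  On the support, an interval, the ratios \<open>p (n + 1) / p n\<close> decrease. The general inequality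
  follows in two inductions that multiply neighbouring instances and cancel positive factors: the
  first on the distance \<open>e\<close> for \<open>d = 1\<close>, the second on \<open>d\<close>.
\<close>

lemma log_concave_four_points:
  fixes p :: "int \<Rightarrow> real"
  assumes nonneg: "\<And>n. 0 \<le> p n"
    and lc: "\<And>n. p (n - 1) * p (n + 1) \<le> (p n)\<^sup>2"
    and interval: "\<And>i j k. p i > 0 \<Longrightarrow> p k > 0 \<Longrightarrow> i \<le> j \<Longrightarrow> j \<le> k \<Longrightarrow> p j > 0"
    and "0 \<le> d" "0 \<le> e"
  shows "p x * p (x + d + e) \<le> p (x + d) * p (x + e)"
proof (cases "p x > 0 \<and> p (x + d + e) > 0")
  case False
  then have "p x * p (x + d + e) = 0"
    using nonneg[of x] nonneg[of "x + d + e"] by (auto simp: less_le)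
  then show ?thesis
    using mult_nonneg_nonneg[OF nonneg[of "x + d"] nonneg[of "x + e"]] by linarith
next
  case True
  then have pos: "p (x + i) > 0" if "0 \<le> i" "i \<le> d + e" for i
    using interval[of x "x + d + e" "x + i"] that by auto
  have step: "p y * p (y + int n + 1) \<le> p (y + 1) * p (y + int n)"
    if "x \<le> y" "y + int n + 1 \<le> x + d + e" for y n
    using that
  proof (induction n)
    case (Suc n)
    have p1: "p (y + int n + 1) > 0" using pos[of "y + int n + 1 - x"] Suc.prems by simp
    have p0: "p (y + int n) > 0" using pos[of "y + int n - x"] Suc.prems by simp
    have "(p y * p (y + int n + 2)) * p (y + int n) = p y * (p (y + int n) * p (y + int n + 2))"
      by (simp add: ac_simps)
    also have "\<dots> \<le> p y * (p (y + int n + 1))\<^sup>2"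
      using lc[of "y + int n + 1"] nonneg by (intro mult_left_mono) (auto simp: algebra_simps)
    also have "\<dots> = (p y * p (y + int n + 1)) * p (y + int n + 1)"
      by (simp add: power2_eq_square)
    also have "\<dots> \<le> (p (y + 1) * p (y + int n)) * p (y + int n + 1)"
      using Suc p1 by (intro mult_right_mono) auto
    finally have "(p y * p (y + int n + 2)) * p (y + int n) \<le>
        (p (y + 1) * p (y + int n + 1)) * p (y + int n)"
      by (simp add: ac_simps)
    then have "p y * p (y + int n + 2) \<le> p (y + 1) * p (y + int n + 1)"
      using p0 by simp
    then show ?case by (simp add: algebra_simps)
  qed (simp add: mult.commute)
  obtain e' where e': "e = int e'" using \<open>0 \<le> e\<close> nonneg_int_cases by blast
  have "p x * p (x + int i + e) \<le> p (x + int i) * p (x + e)" if "int i \<le> d" for i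
    using that
  proof (induction i)
    case (Suc i)
    have p1: "p (x + int i) > 0" using pos[of "int i"] Suc.prems \<open>0 \<le> e\<close> by simp
    have p2: "p (x + int i + e) > 0"
      using pos[of "int i + e"] Suc.prems \<open>0 \<le> e\<close> by (simp add: algebra_simps)
    have "p x * p (x + int i + e + 1) * (p (x + int i) * p (x + int i + e)) =
        (p x * p (x + int i + e)) * (p (x + int i) * p (x + int i + e + 1))"
      by (simp add: ac_simps)
    also have "\<dots> \<le> (p (x + int i) * p (x + e)) * (p (x + int i + 1) * p (x + int i + e))"
      using Suc step[of "x + int i" e'] nonneg
      by (intro mult_mono[OF _ _ mult_nonneg_nonneg mult_nonneg_nonneg]) (simp_all add: e')
    also have "\<dots> = p (x + int i + 1) * p (x + e) * (p (x + int i) * p (x + int i + e))"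
      by (simp add: ac_simps)
    finally have "p x * p (x + int i + e + 1) \<le> p (x + int i + 1) * p (x + e)"
      using p1 p2 by simp
    then show ?case by (simp add: algebra_simps)
  qed simp
  from this[of "nat d"] show ?thesis using \<open>0 \<le> d\<close> by simp
qed

theorem theorem6p2:
  fixes M :: "'a measure" and X Y :: "'a \<Rightarrow> int" and b :: real and \<alpha> :: ereal
  assumes "prob_space M"
    and "prob_space.indep_var M (count_space UNIV) X (count_space UNIV) Y"
    and "distr M (count_space UNIV) X = distr M (count_space UNIV) Y"
    and "log_concave_rv M X" and "log_concave_rv M Y"
    and "b > 1" and "0 < \<alpha>"
  shows "renyi_entropy b \<alpha> M (\<lambda>\<omega>. X \<omega> - Y \<omega>) - renyi_entropy b \<alpha> M X < ereal (log b (c_const \<alpha>))"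
proof -
  interpret prob_space M by fact
  let ?Z = "\<lambda>\<omega>. X \<omega> - Y \<omega>"
  have X: "X \<in> measurable M (count_space UNIV)" and Y: "Y \<in> measurable M (count_space UNIV)"
    using indep_var_rv1[OF assms(2)] indep_var_rv2[OF assms(2)] .
  have Z: "?Z \<in> measurable M (count_space UNIV)"
    using X Y by measurable
  have mass_vimage: "mass M W n = prob (W -` {n} \<inter> space M)" for W n
    unfolding mass_def by (rule arg_cong[where f = prob]) auto
  have mass_sum: "(mass M W has_sum 1) UNIV" if "W \<in> measurable M (count_space UNIV)" for W
  proof -
    have "prob (space M \<inter> (W -` {n} \<inter> space M)) = mass M W n" for n
      unfolding mass_vimage by (rule arg_cong[where f = prob]) auto
    then show ?thesis using has_sum_prob_int[OF that sets.top] by (simp add: prob_space)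
  qed
  have same: "mass M Y n = mass M X n" for n
  proof -
    have "mass M X n = measure (distr M (count_space UNIV) X) {n}"
      using X by (simp add: mass_vimage measure_distr)
    also have "\<dots> = mass M Y n"
      unfolding assms(3) using Y by (simp add: mass_vimage measure_distr)
    finally show ?thesis ..
  qed
  interpret log_concave_difference "mass M X" "mass M ?Z"
  proof
    show "0 \<le> mass M X n" for n by (simp add: mass_def)
    show "(mass M X has_sum 1) UNIV" "(mass M ?Z has_sum 1) UNIV"
      using mass_sum X Z by auto
    show "mass M X x * mass M X (x + d + e) \<le> mass M X (x + d) * mass M X (x + e)"
      if "0 \<le> d" "0 \<le> e" for x d e
    proof (rule log_concave_four_points[OF _ _ _ that])
      show "0 \<le> mass M X n" for n by (simp add: mass_def)
      show "mass M X (n - 1) * mass M X (n + 1) \<le> (mass M X n)\<^sup>2" for n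
        using assms(4) unfolding log_concave_rv_def by blast
      show "mass M X j > 0" if "mass M X i > 0" "mass M X k > 0" "i \<le> j" "j \<le> k" for i j k
        using assms(4) that unfolding log_concave_rv_def by blast
    qed
    show "((\<lambda>m. mass M X (m + n) * mass M X m) has_sum mass M ?Z n) UNIV" for n
    proof -
      have "prob ((?Z -` {n} \<inter> space M) \<inter> (Y -` {m} \<inter> space M)) = mass M X (m + n) * mass M X m" for m
      proof -
        have "(?Z -` {n} \<inter> space M) \<inter> (Y -` {m} \<inter> space M) =
            (\<lambda>\<omega>. (X \<omega>, Y \<omega>)) -` ({m + n} \<times> {m}) \<inter> space M" by auto
        then show ?thesis
          using indep_varD[OF assms(2), of "{m + n}" "{m}"] same[of m] by (simp add: mass_vimage)
      qed
      moreover have "?Z -` {n} \<inter> space M \<in> events" using Z by (rule measurable_sets) simp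
      ultimately show ?thesis
        using has_sum_prob_int[OF Y, of "?Z -` {n} \<inter> space M"] by (simp add: mass_vimage)
    qed
  qed
  show ?thesis using renyi_entropy_difference[OF refl refl assms(6,7)] .
qed

end
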